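(* Let $O=\left(\frac{2}{n},\dots,\frac{2}{n}\right)\in\mathbb{R}^n$. (1) Let $f:\mathbb{C}^n\to\mathbb{C}$ be an analytic function with $f(0)=0$ and $d_0f=0$. If $O\notin N(f)$, then the singularity of $f$ at $0$ is not Morse. (2) If a lattice (infinite) polytope $M\subset\mathbb{R}^n_{\ge 0}$ contains the point $O$, then a generic analytic function $f:\mathbb{C}^n\to\mathbb{C}$ with $f(0)=0$, $d_0f=0$ and $N(f)\subset M$ has a Morse singularity at $0$. The exact condition of being generic here is the following: if $B$ is a generic quadratic form from $\mathbb{C}^{M\cap 2\Delta}$, then any such $f=B(\mathbf{x})+o(\mathbf{x}^2)$ has a Morse singularity at $0$.
   Context: For an analytic function $f=\sum_{k\in\mathbb{Z}^n_{\ge 0}}a_k z_1^{k_1}\cdots z_n^{k_n}$ (power series at $0$), its Newton polytope is the (infinite) polytope $N(f)=\operatorname{conv}\{k+l\in\mathbb{R}^n\mid k\in\mathbb{Z}^n_{\ge 0},\ a_k\ne0,\ l\in\mathbb{R}^n_{\ge 0}\}$. A lattice (infinite) polytope in $\mathbb{R}^n_{\ge 0}$ is a set of this same kind, i.e. $\operatorname{conv}\{k+l\mid k\in S,\ l\in\mathbb{R}^n_{\ge 0}\}$ for a set $S\subset\mathbb{Z}^n_{\ge 0}$. A function $f$ with $f(0)=0$, $d_0f=0$ is said to have a singularity at $0$; the singularity is Morse if the Hessian of $f$ at $0$ is nonzero (equivalently, the quadratic part of $f$ at $0$ is a nondegenerate quadratic form). $2\Delta\subset\mathbb{R}^n$ is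 the convex hull of the points $A_1,\dots,A_n$, where $A_i$ has $i$-th coordinate $2$ and all other coordinates $0$. $\mathbb{C}^{M\cap 2\Delta}$ denotes the vector space of all quadratic forms in $\mathbb{C}[z_1,\dots,z_n]$ all of whose monomials have exponent vectors in $M\cap 2\Delta$; a generic quadratic form in this space means one outside a proper algebraic subvariety of it.
   Formalization: Part (2) also assumes that O lies in the polytope generated by the lattice points of M of degree at least 2; without this it fails, e.g. for n=3 and M generated by (1,0,0) and (0,2,1), where every quadratic form in C^{M∩2Δ} is divisible by z_1. *)

theory Defs
  imports "HOL-Analysis.Analysis" "HOL-Library.Landau_Symbols"
begin

text \<open>Exponent vectors are elements of \<^typ>\<open>nat ^ 'n\<close>; the dimension is \<open>CARD('n)\<close>.\<close>

definition exp_vec :: "nat ^ 'n \<Rightarrow> real ^ 'n" where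
  "exp_vec k = (\<chi> i. real (k $ i))"

definition monomial_at :: "nat ^ 'n \<Rightarrow> complex ^ 'n::finite \<Rightarrow> complex" where
  "monomial_at k z = (\<Prod>i\<in>UNIV. (z $ i) ^ (k $ i))"

definition newton_hull :: "(nat ^ 'n::finite) set \<Rightarrow> (real ^ 'n) set" where
  "newton_hull S = convex hull {exp_vec k + l | k l. k \<in> S \<and> (\<forall>i. 0 \<le> l $ i)}"

definition lattice_polytope :: "(real ^ 'n::finite) set \<Rightarrow> bool" where
  "lattice_polytope M \<longleftrightarrow> (\<exists>S. M = newton_hull S)"

definition has_power_series_0 ::
  "(complex ^ 'n::finite \<Rightarrow> complex) \<Rightarrow> (nat ^ 'n \<Rightarrow> complex) \<Rightarrow> bool" where
  "has_power_series_0 f a \<longleftrightarrow>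
     (\<exists>r>0. \<forall>z. norm z < r \<longrightarrow> ((\<lambda>k. a k * monomial_at k z) has_sum f z) UNIV)"

definition analytic_0 :: "(complex ^ 'n::finite \<Rightarrow> complex) \<Rightarrow> bool" where
  "analytic_0 f \<longleftrightarrow> (\<exists>a. has_power_series_0 f a)"

text \<open>The power series of an analytic function at 0 is unique, so the choice is immaterial.\<close>

definition series_coeff :: "(complex ^ 'n::finite \<Rightarrow> complex) \<Rightarrow> nat ^ 'n \<Rightarrow> complex" where
  "series_coeff f = (SOME a. has_power_series_0 f a)"

definition newton_polytope :: "(complex ^ 'n::finite \<Rightarrow> complex) \<Rightarrow> (real ^ 'n) set" where
  "newton_polytope f = newton_hull {k. series_coeff f k \<noteq> 0}"

definition singular_0 :: "(complex ^ 'n::finite \<Rightarrow> complex) \<Rightarrow> bool" where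
  "singular_0 f \<longleftrightarrow> f 0 = 0 \<and> (f has_derivative (\<lambda>_. 0)) (at 0)"

definition partial_deriv ::
  "'n \<Rightarrow> (complex ^ 'n::finite \<Rightarrow> complex) \<Rightarrow> complex ^ 'n \<Rightarrow> complex" where
  "partial_deriv i f z = deriv (\<lambda>t. f (z + axis i t)) 0"

definition hessian_matrix_0 :: "(complex ^ 'n::finite \<Rightarrow> complex) \<Rightarrow> complex ^ 'n ^ 'n" where
  "hessian_matrix_0 f = (\<chi> i j. partial_deriv i (partial_deriv j f) 0)"

definition morse_0 :: "(complex ^ 'n::finite \<Rightarrow> complex) \<Rightarrow> bool" where
  "morse_0 f \<longleftrightarrow> singular_0 f \<and> det (hessian_matrix_0 f) \<noteq> 0"

definition two_simplex :: "(real ^ 'n::finite) set" where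
  "two_simplex = convex hull (range (\<lambda>i. axis i 2))"

text \<open>Polynomials are given by their coefficient families. For \<open>A \<subseteq> two_simplex\<close> all
  exponents have degree 2, so \<open>poly_space A\<close> then consists of quadratic forms.\<close>

definition poly_space :: "(real ^ 'n::finite) set \<Rightarrow> (nat ^ 'n \<Rightarrow> complex) set" where
  "poly_space A = {b. finite {k. b k \<noteq> 0} \<and> (\<forall>k. b k \<noteq> 0 \<longrightarrow> exp_vec k \<in> A)}"

definition poly_eval :: "(nat ^ 'n::finite \<Rightarrow> complex) \<Rightarrow> complex ^ 'n \<Rightarrow> complex" where
  "poly_eval b z = (\<Sum>k | b k \<noteq> 0. b k * monomial_at k z)"

inductive polynomial_fun :: "(('v \<Rightarrow> complex) \<Rightarrow> complex) \<Rightarrow> bool" where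
  const: "polynomial_fun (\<lambda>b. c)"
| coord: "polynomial_fun (\<lambda>b. b v)"
| add: "polynomial_fun p \<Longrightarrow> polynomial_fun q \<Longrightarrow> polynomial_fun (\<lambda>b. p b + q b)"
| mult: "polynomial_fun p \<Longrightarrow> polynomial_fun q \<Longrightarrow> polynomial_fun (\<lambda>b. p b * q b)"

definition algebraic_subvariety ::
  "('v \<Rightarrow> complex) set \<Rightarrow> ('v \<Rightarrow> complex) set \<Rightarrow> bool" where
  "algebraic_subvariety W V \<longleftrightarrow>
     (\<exists>P. (\<forall>p\<in>P. polynomial_fun p) \<and> V = {b \<in> W. \<forall>p\<in>P. p b = 0})"

definition generically :: "('v \<Rightarrow> complex) set \<Rightarrow> (('v \<Rightarrow> complex) \<Rightarrow> bool) \<Rightarrow> bool" where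
  "generically W Q \<longleftrightarrow> (\<exists>V. algebraic_subvariety W V \<and> V \<noteq> W \<and> (\<forall>b\<in>W - V. Q b))"

definition centre_point :: "real ^ 'n::finite" where
  "centre_point = (\<chi> i. 2 / real CARD('n))"

text \<open>The polytope generated by the exponents in \<open>M\<close> that can occur in a function singular
  at 0; it equals \<open>M\<close> if the lattice points of \<open>M\<close> all have degree at least 2. Requiring
  only \<open>centre_point \<in> M\<close> is not enough for generic forms to be nondegenerate: the polytope
  generated by \<open>(1,0,0)\<close> and \<open>(0,2,1)\<close> contains \<open>(2/3,2/3,2/3)\<close>, but its lattice points
  of degree 2 all have positive first coordinate, so the quadratic forms are divisible by
  the first variable and have rank at most 2.\<close>

definition singular_part :: "(real ^ 'n::finite) set \<Rightarrow> (real ^ 'n) set" where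
  "singular_part M = newton_hull {k. exp_vec k \<in> M \<and> 2 \<le> (\<Sum>i\<in>UNIV. k $ i)}"

end

theory Submission
  imports Defs "HOL-Complex_Analysis.Cauchy_Integral_Formula" "HOL-Computational_Algebra.Primes"
begin

text \<open>Write \<open>H i j\<close> for the Hessian of \<open>f\<close> at 0; up to a factor 2 on the diagonal it is the
  coefficient of \<open>z i * z j\<close>. If \<open>det H \<noteq> 0\<close>, some term of the Leibniz expansion is nonzero, i.e.
  \<open>H i (\<sigma> i) \<noteq> 0\<close> for all \<open>i\<close> and some permutation \<open>\<sigma>\<close>, and \<open>O\<close> is the average of the exponents
  of \<open>z i * z (\<sigma> i)\<close>. Conversely, if \<open>O\<close> lies in the hull of the exponents of degree at least 2,
  Hall's marriage theorem yields a permutation \<open>\<sigma>\<close> for which all these exponents are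
  available. The quadratic form \<open>\<Sum>i. w i * z i * z (\<sigma> i)\<close> is nondegenerate when the weights \<open>w i\<close>
  are distinct primes, so the determinant of the Hessian does not vanish identically on
  the quadratic forms supported in the polytope.\<close>

declare One_nat_def [simp del]

section \<open>Exponent vectors of degree one and two\<close>

lemma degree_1_nat_vec:
  fixes k :: "nat ^ 'n::finite"
  assumes "(\<Sum>i\<in>UNIV. k $ i) = 1"
  obtains i where "k = axis i 1"
proof -
  from assms obtain i where i: "k $ i \<noteq> 0" by (metis sum.neutral zero_neq_one)
  have "(\<Sum>l\<in>UNIV. k $ l) = k $ i + (\<Sum>l\<in>UNIV - {i}. k $ l)"
    by (rule sum.remove) auto
  with i assms have "k $ i = 1" "(\<Sum>l\<in>UNIV - {i}. k $ l) = 0" by linarith+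
  hence "k $ l = axis i 1 $ l" for l by (cases "l = i") (auto simp: axis_def)
  hence "k = axis i 1" by (simp add: vec_eq_iff)
  thus ?thesis by (rule that)
qed

lemma degree_2_nat_vec:
  fixes k :: "nat ^ 'n::finite"
  assumes "(\<Sum>i\<in>UNIV. k $ i) = 2"
  obtains i j where "k = axis i 1 + axis j 1"
proof -
  from assms obtain i where i: "k $ i \<noteq> 0" by (metis sum.neutral zero_neq_numeral)
  define m where "m = k - axis i 1"
  have k: "k = m + axis i 1" using i by (auto simp: vec_eq_iff axis_def m_def)
  have "(\<Sum>l\<in>UNIV. (axis i 1 :: nat ^ 'n) $ l) = 1" by (simp add: axis_def)
  with assms have "(\<Sum>l\<in>UNIV. m $ l) = 1" by (simp add: k sum.distrib)
  then obtain j where "m = axis j 1" by (rule degree_1_nat_vec)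
  thus ?thesis using that[of j i] k by simp
qed

text \<open>Coefficient families supported in degree two are thereby finite, so
  \<open>poly_eval\<close> represents them faithfully.\<close>

lemma finite_degree_nat_vec: "finite {k :: nat ^ 'n::finite. (\<Sum>i\<in>UNIV. k $ i) = 2}"
proof -
  have "{k :: nat ^ 'n. (\<Sum>i\<in>UNIV. k $ i) = 2} \<subseteq> range (\<lambda>(i, j). axis i 1 + axis j 1)"
  proof
    fix k :: "nat ^ 'n" assume "k \<in> {k. (\<Sum>i\<in>UNIV. k $ i) = 2}"
    then obtain i j where "k = axis i 1 + axis j 1" using degree_2_nat_vec by auto
    thus "k \<in> range (\<lambda>(i, j). axis i 1 + axis j 1)" by (intro range_eqI[of _ _ "(i, j)"]) simp
  qed
  thus ?thesis by (rule finite_subset) simp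
qed

subsection \<open>Power series in several variables\<close>

lemma norm_le_if_components_le:
  fixes z :: "complex ^ 'n::finite"
  assumes "\<And>i. norm (z $ i) \<le> R"
  shows "norm z \<le> real CARD('n) * R"
proof -
  have "norm z \<le> (\<Sum>i\<in>UNIV. norm (z $ i))"
    unfolding norm_vec_def by (rule L2_set_le_sum) auto
  also have "\<dots> \<le> (\<Sum>i\<in>(UNIV::'n set). R)"
    by (intro sum_mono assms)
  finally show ?thesis by simp
qed

lemma norm_monomial_at: "norm (monomial_at k z) = (\<Prod>i\<in>UNIV. norm (z $ i) ^ (k $ i))"
  by (simp add: monomial_at_def prod_norm[symmetric] norm_power)

lemma norm_monomial_at_le:
  assumes "\<And>i. norm (z $ i) \<le> s"
  shows "norm (monomial_at k z) \<le> s ^ (\<Sum>i\<in>UNIV. k $ i)"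
  unfolding norm_monomial_at power_sum
  by (intro prod_mono conjI power_mono assms zero_le_power norm_ge_zero)

lemma monomial_at_scale:
  "monomial_at k (c *s z) = c ^ (\<Sum>i\<in>UNIV. k $ i) * monomial_at k z"
  by (simp add: monomial_at_def power_mult_distrib prod.distrib power_sum)

lemma monomial_at_zero: "monomial_at k 0 = (if k = 0 then 1 else 0)"
  by (auto simp: monomial_at_def vec_eq_iff prod_zero_iff)

text \<open>Unconditional summability of complex numbers is absolute, so convergence at the one
  point with all coordinates \<open>R\<close> dominates the series on the closed polydisc of radius
  \<open>R\<close>.\<close>

lemma power_series_majorant:
  fixes f :: "complex ^ 'n::finite \<Rightarrow> complex"
  assumes "has_power_series_0 f a"
  obtains R where "R > 0" "(\<lambda>k. norm (a k) * R ^ (\<Sum>i\<in>UNIV. k $ i)) summable_on UNIV"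
    "\<forall>z. (\<forall>i. norm (z $ i) \<le> R) \<longrightarrow> ((\<lambda>k. a k * monomial_at k z) has_sum f z) UNIV"
proof -
  obtain r where r: "r > 0" "\<And>z. norm z < r \<Longrightarrow> ((\<lambda>k. a k * monomial_at k z) has_sum f z) UNIV"
    using assms unfolding has_power_series_0_def by auto
  \<comment> \<open>Components bounded by \<open>R\<close> bound the norm by
    \<open>CARD('n) * R\<close>, which is \<open>r / 2\<close>.\<close>
  define R where "R = r / (2 * real CARD('n))"
  have R: "R > 0" using r(1) by (simp add: R_def)
  have sm: "((\<lambda>k. a k * monomial_at k z) has_sum f z) UNIV" if "\<And>i. norm (z $ i) \<le> R" for z
  proof (rule r(2))
    have "norm z \<le> real CARD('n) * R" by (rule norm_le_if_components_le) (rule that)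
    also have "\<dots> < r" using r(1) by (simp add: R_def)
    finally show "norm z < r" .
  qed
  define c :: "complex ^ 'n" where "c = (\<chi> i. of_real R)"
  have "(\<lambda>k. a k * monomial_at k c) summable_on UNIV"
    using sm[of c] R by (auto simp: c_def summable_on_def)
  hence "(\<lambda>k. norm (a k * monomial_at k c)) summable_on UNIV"
    by (simp only: summable_on_iff_abs_summable_on_complex)
  moreover have "norm (a k * monomial_at k c) = norm (a k) * R ^ (\<Sum>i\<in>UNIV. k $ i)" for k
    using R by (simp add: norm_mult norm_monomial_at c_def power_sum)
  ultimately have "(\<lambda>k. norm (a k) * R ^ (\<Sum>i\<in>UNIV. k $ i)) summable_on UNIV"
    by simp
  thus ?thesis using that R sm by blast
qed

text \<open>Subtraction of exponents is truncated; for \<open>k $ j = 0\<close> the factor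
  \<open>of_nat (k $ j)\<close> still makes the derivative zero.\<close>

lemma has_field_derivative_monomial_at:
  fixes z :: "complex ^ 'n::finite"
  shows "((\<lambda>t. monomial_at k (z + axis j t)) has_field_derivative
          of_nat (k $ j) * monomial_at (k - axis j 1) (z + axis j t)) (at t)"
proof -
  define P where "P = (\<Prod>i\<in>UNIV - {j}. z $ i ^ (k $ i))"
  have 1: "monomial_at k (z + axis j s) = (z $ j + s) ^ (k $ j) * P" for s
    unfolding monomial_at_def P_def
    by (subst prod.remove[of _ j]) (auto simp: axis_def intro!: prod.cong)
  have 2: "monomial_at (k - axis j 1) (z + axis j s) = (z $ j + s) ^ (k $ j - 1) * P" for s
    unfolding monomial_at_def P_def
    by (subst prod.remove[of _ j]) (auto simp: axis_def intro!: prod.cong)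
  show ?thesis unfolding 1 2
    by (auto intro!: derivative_eq_intros simp: algebra_simps One_nat_def)
qed

lemma axis_0: "axis j 0 = 0"
  by (simp add: vec_eq_iff axis_def)

text \<open>On a disc in direction \<open>j\<close> the majorant makes the finite partial sums
  converge uniformly, so their complex derivatives converge to that of the limit. The result is
  again a power series, which allows iteration up to the Hessian.\<close>

lemma has_power_series_0_partial_deriv:
  fixes f :: "complex ^ 'n::finite \<Rightarrow> complex"
  assumes "has_power_series_0 f a"
  shows "has_power_series_0 (partial_deriv j f) (\<lambda>k. of_nat (k $ j + 1) * a (k + axis j 1))"
proof -
  obtain R where R: "R > 0" "(\<lambda>k. norm (a k) * R ^ (\<Sum>i\<in>UNIV. k $ i)) summable_on UNIV"
    "\<forall>z. (\<forall>i. norm (z $ i) \<le> R) \<longrightarrow> ((\<lambda>k. a k * monomial_at k z) has_sum f z) UNIV"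
    using power_series_majorant[OF assms] .
  have "((\<lambda>k. of_nat (k $ j + 1) * a (k + axis j 1) * monomial_at k z)
          has_sum partial_deriv j f z) UNIV" if z: "norm z < R / 2" for z
  proof -
    \<comment> \<open>Base point and displacement get half of \<open>R\<close> each, so the disc
      stays inside the polydisc of the majorant.\<close>
    have bd: "norm ((z + axis j t) $ i) \<le> R" if "t \<in> cball 0 (R / 2)" for t i
    proof -
      have "norm ((z + axis j t) $ i) \<le> norm (z $ i) + norm (axis j t $ i)"
        by (simp add: norm_triangle_ineq)
      also have "\<dots> \<le> R / 2 + R / 2"
        using that R(1) z Finite_Cartesian_Product.norm_nth_le[of z i]
        by (intro add_mono) (auto simp: axis_def)
      finally show ?thesis by simp
    qed
    define F where "F = (\<lambda>A t. \<Sum>k\<in>A. a k * monomial_at k (z + axis j t))"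
    define F' where
      "F' = (\<lambda>A t. \<Sum>k\<in>A. a k * (of_nat (k $ j) * monomial_at (k - axis j 1) (z + axis j t)))"
    have D: "(F A has_field_derivative F' A t) (at t)" for A t
      unfolding F_def F'_def
      by (intro DERIV_sum DERIV_cmult has_field_derivative_monomial_at)
    have ul: "uniform_limit (cball 0 (R / 2)) F (\<lambda>t. f (z + axis j t)) (finite_subsets_at_top UNIV)"
      unfolding F_def
    proof (rule Weierstrass_m_test_general'[OF _ _ R(2)])
      fix k t assume "t \<in> cball (0::complex) (R / 2)"
      thus "norm (a k * monomial_at k (z + axis j t)) \<le> norm (a k) * R ^ (\<Sum>i\<in>UNIV. k $ i)"
        unfolding norm_mult by (intro mult_left_mono norm_monomial_at_le bd) auto
    next
      fix t assume "t \<in> cball (0::complex) (R / 2)"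
      thus "((\<lambda>k. a k * monomial_at k (z + axis j t)) has_sum f (z + axis j t)) UNIV"
        by (intro R(3)[rule_format] bd)
    qed
    obtain g' where g': "\<And>w. w \<in> ball 0 (R / 2) \<Longrightarrow>
        ((\<lambda>t. f (z + axis j t)) has_field_derivative g' w) (at w) \<and>
        ((\<lambda>A. F' A w) \<longlongrightarrow> g' w) (finite_subsets_at_top UNIV)"
    proof (rule has_complex_derivative_uniform_limit[OF _ ul])
      show "\<forall>\<^sub>F A in finite_subsets_at_top UNIV. continuous_on (cball 0 (R / 2)) (F A) \<and>
              (\<forall>w\<in>ball 0 (R / 2). (F A has_field_derivative F' A w) (at w))"
        using D by (intro always_eventually) (meson DERIV_continuous_on has_field_derivative_at_within)
    qed (use R(1) in auto)
    have "((\<lambda>A. F' A 0) \<longlongrightarrow> g' 0) (finite_subsets_at_top UNIV)"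
      and d0: "((\<lambda>t. f (z + axis j t)) has_field_derivative g' 0) (at 0)"
      using g'[of 0] R(1) by auto
    hence "((\<lambda>k. a k * (of_nat (k $ j) * monomial_at (k - axis j 1) z)) has_sum g' 0) UNIV"
      by (simp add: has_sum_def F'_def axis_0)
    moreover have "g' 0 = partial_deriv j f z"
      unfolding partial_deriv_def using DERIV_imp_deriv[OF d0] ..
    ultimately have "((\<lambda>k. a k * (of_nat (k $ j) * monomial_at (k - axis j 1) z))
        has_sum partial_deriv j f z) UNIV"
      by simp
    \<comment> \<open>Terms with \<open>k $ j = 0\<close> vanish; on the other exponents truncated
      subtraction of \<open>axis j 1\<close> inverts the shift.\<close>
    also have "?this \<longleftrightarrow> ((\<lambda>k. a k * (of_nat (k $ j) * monomial_at (k - axis j 1) z))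
        has_sum partial_deriv j f z) {k. k $ j \<noteq> 0}"
      by (rule has_sum_cong_neutral) auto
    also have "\<dots> \<longleftrightarrow> ((\<lambda>k. of_nat (k $ j + 1) * a (k + axis j 1) * monomial_at k z)
          has_sum partial_deriv j f z) UNIV"
    proof (rule has_sum_reindex_bij_witness[where i = "\<lambda>k. k + axis j 1" and j = "\<lambda>k. k - axis j 1"])
      fix k :: "nat ^ 'n" assume "k \<in> {k. k $ j \<noteq> 0}"
      thus inv: "k - axis j 1 + axis j 1 = k" by (auto simp: vec_eq_iff axis_def)
      hence "k $ j = (k - axis j 1) $ j + 1" by (metis axis_nth vector_add_component)
      with inv show "of_nat ((k - axis j 1) $ j + 1) * a (k - axis j 1 + axis j 1) *
          monomial_at (k - axis j 1) z = a k * (of_nat (k $ j) * monomial_at (k - axis j 1) z)"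
        by simp
    qed (auto simp: vec_eq_iff axis_def)
    finally show ?thesis .
  qed
  thus ?thesis unfolding has_power_series_0_def using R(1) by (intro exI[of _ "R / 2"]) auto
qed

section \<open>Coefficients of low degree and the Hessian\<close>

lemma has_power_series_0_at_0:
  assumes "has_power_series_0 f a"
  shows "f 0 = a 0"
proof -
  have "((\<lambda>k. a k * monomial_at k 0) has_sum f 0) UNIV"
    using assms unfolding has_power_series_0_def by force
  moreover have "((\<lambda>k. a k * monomial_at k 0) has_sum a 0) UNIV"
    by (rule has_sum_finite_neutralI[of "{0}"]) (auto simp: monomial_at_zero)
  ultimately show ?thesis by (rule has_sum_unique)
qed

lemma partial_deriv_0_eq_coeff:
  assumes "has_power_series_0 f a"
  shows "partial_deriv i f 0 = a (axis i 1)"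
  using has_power_series_0_at_0[OF has_power_series_0_partial_deriv[OF assms, of i]] by simp

text \<open>Taken on coefficient families instead of functions, so that its determinant is a
  polynomial in the coefficients. The diagonal 2 is the second derivative of a square.\<close>

definition form_hessian :: "(nat ^ 'n \<Rightarrow> complex) \<Rightarrow> complex ^ 'n ^ 'n::finite" where
  "form_hessian b = (\<chi> i j. (if i = j then 2 else 1) * b (axis i 1 + axis j 1))"

lemma hessian_matrix_0_eq_form_hessian:
  assumes "has_power_series_0 f a"
  shows "hessian_matrix_0 f = form_hessian a"
proof -
  have "hessian_matrix_0 f $ i $ j = form_hessian a $ i $ j" for i j
    \<comment> \<open>The inner derivative in direction \<open>j\<close> contributes the factor
      \<open>axis i 1 $ j + 1\<close>, which is 2 for \<open>i = j\<close> and 1 otherwise.\<close>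
    using partial_deriv_0_eq_coeff[OF has_power_series_0_partial_deriv[OF assms, of j], of i]
    by (auto simp: hessian_matrix_0_def form_hessian_def axis_def)
  thus ?thesis by (simp add: vec_eq_iff)
qed

section \<open>The quadratic part and cubic remainders\<close>

lemma has_power_series_0_poly_eval:
  assumes "finite {k. b k \<noteq> 0}"
  shows "has_power_series_0 (poly_eval b) b"
  unfolding has_power_series_0_def poly_eval_def
  by (intro exI[of _ 1] conjI allI impI has_sum_finite_neutralI[OF assms]) auto

lemma has_power_series_0_diff:
  assumes "has_power_series_0 f a" "has_power_series_0 g b"
  shows "has_power_series_0 (\<lambda>z. f z - g z) (\<lambda>k. a k - b k)"
proof -
  obtain r s where rs: "r > 0" "s > 0"
    and f: "\<And>z. norm z < r \<Longrightarrow> ((\<lambda>k. a k * monomial_at k z) has_sum f z) UNIV"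
    and g: "\<And>z. norm z < s \<Longrightarrow> ((\<lambda>k. b k * monomial_at k z) has_sum g z) UNIV"
    using assms unfolding has_power_series_0_def by blast
  have "((\<lambda>k. a k * monomial_at k z + - (b k * monomial_at k z)) has_sum f z + - g z) UNIV"
    if "norm z < min r s" for z
    by (rule has_sum_add[OF f has_sum_uminusI[OF g]]) (use that in simp_all)
  thus ?thesis unfolding has_power_series_0_def using rs
    by (intro exI[of _ "min r s"]) (simp add: left_diff_distrib)
qed

text \<open>For \<open>norm z < R\<close> the quotient \<open>norm z / R\<close> is below 1, so a
  term of degree at least 3 is at most \<open>(norm z / R) ^ 3\<close> times its majorant.\<close>

lemma power_series_order_3_bound:
  fixes f :: "complex ^ 'n::finite \<Rightarrow> complex"
  assumes "has_power_series_0 f a"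
    and low: "\<And>k. (\<Sum>i\<in>UNIV. k $ i) < 3 \<Longrightarrow> a k = 0"
  obtains C r where "r > 0" "\<And>z. norm z < r \<Longrightarrow> norm (f z) \<le> C * norm z ^ 3"
proof -
  obtain R where R: "R > 0" "(\<lambda>k. norm (a k) * R ^ (\<Sum>i\<in>UNIV. k $ i)) summable_on UNIV"
    "\<forall>z. (\<forall>i. norm (z $ i) \<le> R) \<longrightarrow> ((\<lambda>k. a k * monomial_at k z) has_sum f z) UNIV"
    using power_series_majorant[OF assms(1)] .
  define T where "T = (\<Sum>\<^sub>\<infinity>k. norm (a k) * R ^ (\<Sum>i\<in>UNIV. k $ i))"
  have T: "((\<lambda>k. (norm z / R) ^ 3 * (norm (a k) * R ^ (\<Sum>i\<in>UNIV. k $ i)))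
             has_sum ((norm z / R) ^ 3 * T)) UNIV" for z :: "complex ^ 'n"
    unfolding T_def by (rule has_sum_cmult_right[OF has_sum_infsum[OF R(2)]])
  have "norm (f z) \<le> T / R ^ 3 * norm z ^ 3" if z: "norm z < R" for z
  proof -
    have hs: "((\<lambda>k. a k * monomial_at k z) has_sum f z) UNIV"
      using z by (intro R(3)[rule_format]) (meson Finite_Cartesian_Product.norm_nth_le less_imp_le order_trans)
    hence "(\<lambda>k. norm (a k * monomial_at k z)) summable_on UNIV"
      by (metis has_sum_imp_summable summable_on_iff_abs_summable_on_complex)
    then obtain n where n: "((\<lambda>k. norm (a k * monomial_at k z)) has_sum n) UNIV"
      by (auto simp: summable_on_def)
    have "n \<le> (norm z / R) ^ 3 * T"
    proof (rule has_sum_mono[OF n T])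
      fix k :: "nat ^ 'n"
      let ?d = "\<Sum>i\<in>UNIV. k $ i"
      show "norm (a k * monomial_at k z) \<le> (norm z / R) ^ 3 * (norm (a k) * R ^ ?d)"
      proof (cases "?d < 3")
        case True thus ?thesis using low[of k] by simp
      next
        case False
        have "norm (monomial_at k z) \<le> norm z ^ ?d"
          by (rule norm_monomial_at_le) (rule Finite_Cartesian_Product.norm_nth_le)
        also have "\<dots> = (norm z / R) ^ ?d * R ^ ?d"
          using R(1) by (simp add: power_divide)
        also have "\<dots> \<le> (norm z / R) ^ 3 * R ^ ?d"
          using R(1) z False by (intro mult_right_mono power_decreasing) auto
        finally have "norm (a k) * norm (monomial_at k z) \<le> norm (a k) * ((norm z / R) ^ 3 * R ^ ?d)"
          by (rule mult_left_mono) simp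
        thus ?thesis by (simp only: norm_mult mult_ac)
      qed
    qed
    with norm_has_sum_bound[OF n hs] have "norm (f z) \<le> (norm z / R) ^ 3 * T"
      by (rule order_trans)
    thus ?thesis by (simp add: power_divide mult.commute)
  qed
  with R(1) show ?thesis by (rule that)
qed

text \<open>Along the ray through \<open>v\<close> both sides of the estimate scale with the square
  of the parameter, so the bound near 0 carries over to \<open>v\<close> with an arbitrarily small
  constant.\<close>

lemma smallo_homogeneous_eq_0:
  fixes q :: "complex ^ 'n::finite \<Rightarrow> complex"
  assumes hom: "\<And>c z. q (c *s z) = c ^ 2 * q z"
    and small: "q \<in> o[at 0](\<lambda>z. of_real (norm z ^ 2))"
  shows "q v = 0"
proof (cases "v = 0")
  case True thus ?thesis using hom[of 0 v] by simp
next
  case False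
  have "norm (q v) \<le> e" if "e > 0" for e
  proof -
    \<comment> \<open>Chosen so that the final bound \<open>c * norm v ^ 2\<close> equals
      \<open>e\<close>.\<close>
    define c where "c = e / norm v ^ 2"
    have "c > 0" using that False by (simp add: c_def)
    then have "\<forall>\<^sub>F z in at 0. norm (q z) \<le> c * norm (of_real (norm z ^ 2) :: complex)"
      using small by (rule landau_o.smallD[rotated])
    then obtain d where d: "d > 0"
      "\<And>z. z \<noteq> 0 \<Longrightarrow> norm z < d \<Longrightarrow> norm (q z) \<le> c * norm z ^ 2"
      unfolding eventually_at by (auto simp: dist_norm norm_power)
    \<comment> \<open>This puts the scaled vector at norm \<open>d / 2\<close>.\<close>
    define t where "t = d / (2 * norm v)"
    have t: "t > 0" using d(1) False by (simp add: t_def)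
    have nv: "norm (complex_of_real t *s v) = t * norm v"
      using t by (simp add: norm_vec_def norm_mult L2_set_right_distrib)
    have nv_less: "norm (complex_of_real t *s v) < d"
      unfolding nv using False d(1) by (simp add: t_def)
    have "norm (complex_of_real t *s v) \<noteq> 0" unfolding nv using t False by simp
    hence "complex_of_real t *s v \<noteq> 0" by (simp only: norm_eq_zero not_False_eq_True)
    from d(2)[OF this nv_less] have "t ^ 2 * norm (q v) \<le> t ^ 2 * (c * norm v ^ 2)"
      unfolding nv hom norm_mult norm_power norm_of_real power_mult_distrib power2_abs
      by (simp only: mult.left_commute)
    hence "norm (q v) \<le> c * norm v ^ 2" using t by (simp only: mult_le_cancel_left_pos zero_less_power)
    thus ?thesis using False by (simp add: c_def)
  qed
  hence "norm (q v) \<le> 0" by (rule field_le_epsilon) simp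
  thus ?thesis by simp
qed

lemma singular_0_low_coeff:
  fixes f :: "complex ^ 'n::finite \<Rightarrow> complex"
  assumes "has_power_series_0 f a" "singular_0 f" "(\<Sum>i\<in>UNIV. k $ i) < 2"
  shows "a k = 0"
proof (cases "k = 0")
  case True
  thus ?thesis using has_power_series_0_at_0[OF assms(1)] assms(2) by (simp add: singular_0_def)
next
  case False
  hence "(\<Sum>i\<in>UNIV. k $ i) \<noteq> 0" by (simp add: vec_eq_iff)
  hence "(\<Sum>i\<in>UNIV. k $ i) = 1" using assms(3) by linarith
  then obtain i where k: "k = axis i 1" by (rule degree_1_nat_vec)
  have "((\<lambda>t. f (0 + axis i t)) has_derivative (\<lambda>_. 0)) (at 0)"
  proof -
    have ax: "((\<lambda>t. axis i t) has_derivative (\<lambda>t. axis i t)) (at (0::complex))"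
      by (intro bounded_linear_imp_has_derivative linear_conv_bounded_linear[THEN iffD1] linearI)
         (auto simp: vec_eq_iff axis_def)
    have "(f has_derivative (\<lambda>_. 0)) (at (axis i (0::complex)))"
      using assms(2) unfolding axis_0 by (simp add: singular_0_def)
    from has_derivative_compose[OF ax this] show ?thesis by simp
  qed
  \<comment> \<open>The zero map is complex linear, so the real derivative in
    \<open>singular_0\<close> yields a complex one along the axis.\<close>
  hence "((\<lambda>t. f (0 + axis i t)) has_field_derivative 0) (at 0)"
    by (simp add: has_field_derivative_def lambda_zero)
  hence "partial_deriv i f 0 = 0" unfolding partial_deriv_def by (rule DERIV_imp_deriv)
  thus ?thesis using partial_deriv_0_eq_coeff[OF assms(1), of i] k by simp
qed

text \<open>The difference of \<open>f\<close> and the form is its degree-two part plus a cubic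
  remainder. That part is therefore of smaller order than \<open>norm z ^ 2\<close>, and being
  homogeneous of degree 2 it vanishes.\<close>

lemma quadratic_coeff_eq_if_smallo:
  fixes f :: "complex ^ 'n::finite \<Rightarrow> complex"
  assumes a: "has_power_series_0 f a" and "singular_0 f"
    and b: "\<And>k. b k \<noteq> 0 \<Longrightarrow> (\<Sum>i\<in>UNIV. k $ i) = 2"
    and small: "(\<lambda>z. f z - poly_eval b z) \<in> o[at 0](\<lambda>z. of_real (norm z ^ 2))"
  shows "a (axis i 1 + axis j 1) = b (axis i 1 + axis j 1)"
proof -
  let ?deg = "\<lambda>k :: nat ^ 'n. \<Sum>i\<in>UNIV. k $ i"
  define c where "c = (\<lambda>k. if ?deg k = 2 then a k - b k else 0)"
  have c2: "?deg k = 2" if "c k \<noteq> 0" for k using that by (auto simp: c_def split: if_splits)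
  have fin: "finite {k. d k \<noteq> 0}" if "\<And>k. d k \<noteq> 0 \<Longrightarrow> ?deg k = 2" for d :: "nat ^ 'n \<Rightarrow> complex"
    by (rule finite_subset[OF _ finite_degree_nat_vec]) (use that in auto)
  have psc: "has_power_series_0 (poly_eval c) c"
    by (intro has_power_series_0_poly_eval fin c2)
  let ?g = "\<lambda>z. f z - poly_eval b z"
  have "has_power_series_0 (\<lambda>z. ?g z - poly_eval c z) (\<lambda>k. a k - b k - c k)"
    by (intro has_power_series_0_diff a psc has_power_series_0_poly_eval fin b)
  \<comment> \<open>Degrees 0 and 1 vanish since \<open>f\<close> is singular and \<open>b\<close>
    lives in degree 2; degree 2 vanishes by the choice of \<open>c\<close>.\<close>
  moreover have "a k - b k - c k = 0" if "?deg k < 3" for k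
    using that singular_0_low_coeff[OF a \<open>singular_0 f\<close>, of k] b[of k]
    by (cases "?deg k = 2") (auto simp: c_def)
  ultimately obtain r C where Cr: "r > 0"
    "\<And>z. norm z < r \<Longrightarrow> norm (?g z - poly_eval c z) \<le> C * norm z ^ 3"
    using power_series_order_3_bound by blast
  have "(\<lambda>z. ?g z - poly_eval c z) \<in> O[at 0](\<lambda>z. of_real (norm z ^ 3))"
    by (rule bigoI[of _ C]) (use Cr in \<open>auto simp: eventually_at dist_norm norm_power\<close>)
  also have "(\<lambda>z. complex_of_real (norm z ^ 3)) \<in> o[at (0 :: complex ^ 'n)](\<lambda>z. of_real (norm z ^ 2))"
  proof (rule landau_o.smallI)
    fix e :: real assume "e > 0"
    have "norm z ^ 3 \<le> e * norm z ^ 2" if "norm z < e" for z :: "complex ^ 'n"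
      using that mult_right_mono[of "norm z" e "norm z ^ 2"] by (simp add: power_numeral_reduce)
    thus "\<forall>\<^sub>F z in at (0 :: complex ^ 'n). norm (complex_of_real (norm z ^ 3))
            \<le> e * norm (complex_of_real (norm z ^ 2))"
      using \<open>e > 0\<close> by (auto simp: eventually_at dist_norm norm_power)
  qed
  finally have "(\<lambda>z. ?g z - (?g z - poly_eval c z)) \<in> o[at 0](\<lambda>z. of_real (norm z ^ 2))"
    by (rule sum_in_smallo(2)[OF small])
  moreover have "(\<lambda>z. ?g z - (?g z - poly_eval c z)) = poly_eval c" by auto
  ultimately have o: "poly_eval c \<in> o[at 0](\<lambda>z. of_real (norm z ^ 2))" by simp
  have hom: "poly_eval c (t *s z) = t ^ 2 * poly_eval c z" for t z
    unfolding poly_eval_def sum_distrib_left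
    by (intro sum.cong) (auto simp: monomial_at_scale c2)
  have "poly_eval c v = 0" for v
    using hom o by (rule smallo_homogeneous_eq_0)
  hence "poly_eval c = (\<lambda>_. 0)" by auto
  \<comment> \<open>To pass from the zero function to zero coefficients, the Hessian of
    \<open>poly_eval c\<close> is computed once from the function and once from its series.\<close>
  hence "hessian_matrix_0 (poly_eval c) $ i $ j = 0"
    by (simp add: hessian_matrix_0_def partial_deriv_def)
  hence "c (axis i 1 + axis j 1) = 0"
    unfolding hessian_matrix_0_eq_form_hessian[OF psc]
    by (auto simp: form_hessian_def split: if_splits)
  moreover have "?deg (axis i 1 + axis j 1) = 2"
    by (simp add: sum.distrib axis_def)
  ultimately show ?thesis by (simp add: c_def)
qed

subsection \<open>Hall's marriage theorem\<close>

text \<open>Induction on \<open>I\<close> after Halmos and Vaughan. If a nonempty proper subset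
  attains Hall's bound with equality, it and its complement are matched separately; otherwise each
  such subset has a spare neighbour, and one pair can be fixed arbitrarily.\<close>

lemma hall_marriage:
  fixes S :: "'a \<Rightarrow> 'b::finite set"
  assumes "finite I" "\<And>J. J \<subseteq> I \<Longrightarrow> card J \<le> card (\<Union>(S ` J))"
  obtains f where "inj_on f I" "\<And>i. i \<in> I \<Longrightarrow> f i \<in> S i"
proof -
  have "\<exists>f. inj_on f I \<and> (\<forall>i\<in>I. f i \<in> S i)"
    using assms
  proof (induction I arbitrary: S rule: finite_psubset_induct)
    case (psubset I)
    note hall = psubset.prems
    consider "I = {}"
      | (tight) J where "J \<noteq> {}" "J \<subset> I" "card (\<Union>(S ` J)) = card J"
      | (loose) i where "i \<in> I" "\<And>J. J \<noteq> {} \<Longrightarrow> J \<subset> I \<Longrightarrow> card J < card (\<Union>(S ` J))"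
      using hall by (metis equals0I le_neq_implies_less psubset_imp_subset)
    thus ?case
    proof cases
      case 1
      thus ?thesis by auto
    next
      case tight
      have finJ: "finite J" using tight(2) psubset.hyps finite_subset by blast
      from tight obtain f where f: "inj_on f J" "\<forall>i\<in>J. f i \<in> S i"
        using psubset.IH[of J S] hall by (meson order_trans psubset_imp_subset)
      define S' where "S' = (\<lambda>i. S i - \<Union>(S ` J))"
      \<comment> \<open>Subtracting the equality for \<open>J\<close> from Hall's bound for the
        union of \<open>J\<close> and \<open>K\<close> leaves the bound for
        \<open>K\<close>.\<close>
      have "card K \<le> card (\<Union>(S' ` K))" if K: "K \<subseteq> I - J" for K
      proof -
        have finK: "finite K" using K psubset.hyps finite_subset by blast
        have "card J + card K = card (J \<union> K)"
          using K by (intro card_Un_disjoint[symmetric] finJ finK) auto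
        also have "\<dots> \<le> card (\<Union>(S ` (J \<union> K)))"
          using K tight(2) by (intro hall) auto
        also have "\<Union>(S ` (J \<union> K)) = \<Union>(S ` J) \<union> \<Union>(S' ` K)"
          by (auto simp: S'_def)
        also have "card \<dots> \<le> card (\<Union>(S ` J)) + card (\<Union>(S' ` K))"
          by (rule card_Un_le)
        finally show ?thesis using tight(3) by simp
      qed
      moreover have "I - J \<subset> I" using tight by auto
      ultimately obtain g where g: "inj_on g (I - J)" "\<forall>i\<in>I - J. g i \<in> S' i"
        using psubset.IH[of "I - J" S'] by blast
      have "inj_on (\<lambda>i. if i \<in> J then f i else g i) (J \<union> (I - J))"
      proof (intro inj_on_disjoint_Un f(1) g(1))
        show "f ` J \<inter> g ` (I - J) = {}" using f(2) g(2) by (fastforce simp: S'_def)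
      qed
      moreover have "J \<union> (I - J) = I" using tight by auto
      ultimately show ?thesis using f g
        by (intro exI[of _ "\<lambda>i. if i \<in> J then f i else g i"]) (auto simp: S'_def)
    next
      case loose
      have "card {i} \<le> card (S i)" using hall[of "{i}"] loose(1) by simp
      then obtain s where s: "s \<in> S i" by fastforce
      define S' where "S' = (\<lambda>i. S i - {s})"
      \<comment> \<open>Deleting \<open>s\<close> costs a union at most one element, which the
        strict bound pays for.\<close>
      have "card K \<le> card (\<Union>(S' ` K))" if K: "K \<subseteq> I - {i}" for K
      proof (cases "K = {}")
        case False
        hence "card K < card (\<Union>(S ` K))" using K loose by (intro loose(2)) auto
        also have "\<Union>(S ` K) \<subseteq> insert s (\<Union>(S' ` K))" by (auto simp: S'_def)
        hence "card (\<Union>(S ` K)) \<le> card (insert s (\<Union>(S' ` K)))" by (intro card_mono) auto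
        also have "\<dots> \<le> Suc (card (\<Union>(S' ` K)))" by (rule card_insert_le_m1) auto
        finally show ?thesis by simp
      qed simp
      then obtain g where g: "inj_on g (I - {i})" "\<forall>l\<in>I - {i}. g l \<in> S' l"
        using psubset.IH[of "I - {i}" S'] loose(1) by blast
      have "inj_on (g(i := s)) I"
        using g by (auto simp: inj_on_def S'_def)
      moreover have "\<forall>l\<in>I. (g(i := s)) l \<in> S l" using g s by (auto simp: S'_def)
      ultimately show ?thesis by blast
    qed
  qed
  thus ?thesis using that by blast
qed

subsection \<open>Nondegenerate quadratic forms from permutations\<close>

text \<open>The iterates of \<open>i\<close> repeat by pigeonhole, and injectivity cancels the
  smaller number of steps.\<close>

lemma bij_finite_period:
  fixes \<sigma> :: "'n::finite \<Rightarrow> 'n"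
  assumes "bij \<sigma>"
  obtains m where "m > 0" "(\<sigma> ^^ m) i = i"
proof -
  have "\<not> inj (\<lambda>m. (\<sigma> ^^ m) i)"
    using finite_imageD[of "\<lambda>m. (\<sigma> ^^ m) i" UNIV] by (auto simp: finite_subset[OF subset_UNIV])
  then obtain p q where pq: "(\<sigma> ^^ p) i = (\<sigma> ^^ q) i" "p < q"
    by (metis injI linorder_neqE_nat)
  have "(\<sigma> ^^ p) ((\<sigma> ^^ (q - p)) i) = (\<sigma> ^^ p) i"
    using pq funpow_add[of p "q - p" \<sigma>] by simp
  moreover have "inj (\<sigma> ^^ p)" using assms by (simp add: bij_is_inj inj_fn)
  ultimately have "(\<sigma> ^^ (q - p)) i = i" by (rule injD[rotated])
  thus ?thesis using that[of "q - p"] pq by simp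
qed

lemma inj_primes:
  obtains w :: "'n::finite \<Rightarrow> nat" where "inj w" "\<And>i. prime (w i)"
proof -
  obtain P where P: "P \<subseteq> {p :: nat. prime p}" "finite P" "card P = CARD('n)"
    using infinite_arbitrarily_large[OF primes_infinite] by metis
  then obtain w :: "'n \<Rightarrow> nat" where "bij_betw w UNIV P"
    using finite_same_card_bij[of "UNIV :: 'n set" P] by auto
  thus ?thesis using P that[of w] by (auto simp: bij_betw_def)
qed

text \<open>The Hessian of the sum of all \<open>w i * z i * z (\<sigma> i)\<close>. Both summands
  contribute where \<open>\<sigma>\<close> swaps \<open>i\<close> and \<open>j\<close>, and on the
  diagonal at a fixed point.\<close>

definition perm_form :: "('n \<Rightarrow> 'n) \<Rightarrow> ('n \<Rightarrow> nat) \<Rightarrow> complex ^ 'n ^ 'n::finite" where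
  "perm_form \<sigma> w = (\<chi> i j. (if \<sigma> i = j then of_nat (w i) else 0)
                         + (if \<sigma> j = i then of_nat (w j) else 0))"

text \<open>A vector \<open>x\<close> in the kernel satisfies \<open>w (\<sigma> l) * x (\<sigma> (\<sigma> l)) = - w l * x l\<close>. Running once
  around the \<open>\<sigma>\<^sup>2\<close>-orbit of a point \<open>i\<close> with \<open>x i \<noteq> 0\<close> gives \<open>P = Q\<close> and an even number of
  steps, where \<open>P\<close> and \<open>Q\<close> multiply the weights at the odd and even iterates. The sign excludes an
  odd \<open>\<sigma>\<close>-period, and unique factorisation forces one.\<close>

lemma det_perm_form_nonzero:
  fixes \<sigma> :: "'n::finite \<Rightarrow> 'n"
  assumes "bij \<sigma>" "inj w" and prime: "\<And>i. prime (w i)"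
  shows "det (perm_form \<sigma> w) \<noteq> 0"
proof -
  have "x = 0" if x: "perm_form \<sigma> w *v x = 0" for x
  proof -
    have step: "of_nat (w (\<sigma> l)) * x $ \<sigma> (\<sigma> l) = - (of_nat (w l) * x $ l)" for l
    proof -
      \<comment> \<open>Injectivity leaves only the columns \<open>\<sigma> (\<sigma> l)\<close> and
        \<open>l\<close> in row \<open>\<sigma> l\<close>.\<close>
      have "\<sigma> j = \<sigma> l \<longleftrightarrow> j = l" for j using \<open>bij \<sigma>\<close> by (metis bij_pointE)
      hence "(perm_form \<sigma> w *v x) $ \<sigma> l = of_nat (w (\<sigma> l)) * x $ \<sigma> (\<sigma> l) + of_nat (w l) * x $ l"
        by (simp add: perm_form_def matrix_vector_mult_def distrib_right sum.distrib
            if_distrib[where f = "\<lambda>c. c * _"] cong: if_cong)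
      thus ?thesis using x by (simp add: eq_neg_iff_add_eq_0)
    qed
    have "x $ i = 0" for i
    proof (rule ccontr)
      assume xi: "x $ i \<noteq> 0"
      define P where "P = (\<lambda>p. \<Prod>q<p. w ((\<sigma> ^^ (2 * q + 1)) i))"
      define Q where "Q = (\<lambda>p. \<Prod>q<p. w ((\<sigma> ^^ (2 * q)) i))"
      have pos: "P p > 0" "Q p > 0" for p
        using prime by (auto simp: P_def Q_def intro!: prod_pos prime_gt_0_nat)
      have iter: "of_nat (P p) * x $ ((\<sigma> ^^ (2 * p)) i) = (-1) ^ p * of_nat (Q p) * x $ i" for p
      proof (induction p)
        case 0
        show ?case by (simp add: P_def Q_def)
      next
        case (Suc p)
        let ?l = "(\<sigma> ^^ (2 * p)) i"
        have "of_nat (P (Suc p)) * x $ ((\<sigma> ^^ (2 * Suc p)) i)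
                = of_nat (P p) * (of_nat (w (\<sigma> ?l)) * x $ \<sigma> (\<sigma> ?l))"
          by (simp add: P_def mult_ac add_Suc_right One_nat_def)
        also have "\<dots> = - of_nat (w ?l) * (of_nat (P p) * x $ ?l)"
          unfolding step by (simp add: mult_ac)
        also have "\<dots> = (-1) ^ Suc p * of_nat (Q (Suc p)) * x $ i"
          unfolding Suc.IH by (simp add: Q_def mult_ac)
        finally show ?case .
      qed
      have closed: "even p \<and> P p = Q p" if "(\<sigma> ^^ (2 * p)) i = i" for p
      proof -
        have "(of_nat (P p) :: complex) = (-1) ^ p * of_nat (Q p)"
          using iter[of p] that xi by simp
        thus ?thesis
        proof (cases "even p")
          case False
          with \<open>of_nat (P p) = _\<close> have "(of_nat (P p + Q p) :: complex) = 0" by simp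
          hence "P p + Q p = 0" by (simp only: of_nat_eq_0_iff)
          thus ?thesis using pos[of p] by simp
        qed simp
      qed
      have no_odd: False if "odd m" "(\<sigma> ^^ m) i = i" for m
      proof -
        \<comment> \<open>\<open>closed\<close> counts double steps, so an odd period
          \<open>m\<close> is traversed twice; then \<open>m\<close> itself is the exponent of the
          sign.\<close>
        have "(\<sigma> ^^ (2 * m)) i = i" using that(2) by (simp add: mult_2 funpow_add)
        thus False using closed[of m] that(1) by simp
      qed
      obtain m where m: "m > 0" "(\<sigma> ^^ m) i = i" using bij_finite_period[OF \<open>bij \<sigma>\<close>] .
      with no_odd obtain p where p: "m = 2 * p" by blast
      \<comment> \<open>\<open>w i\<close> is the factor of \<open>Q p\<close> at
        \<open>q = 0\<close>; being prime, it must divide one of the weights at odd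
        iterates.\<close>
      have "w i dvd Q p" unfolding Q_def
        using m(1) p by (intro dvd_prodI[of "{..<p}" 0 "\<lambda>q. w ((\<sigma> ^^ (2 * q)) i)", simplified]) auto
      hence "w i dvd P p" using closed[of p] m(2) p by simp
      then obtain q where "w i dvd w ((\<sigma> ^^ (2 * q + 1)) i)"
        unfolding P_def using prime by (auto simp: prime_dvd_prod_iff)
      hence "w i = w ((\<sigma> ^^ (2 * q + 1)) i)" using prime primes_dvd_imp_eq by blast
      hence "(\<sigma> ^^ (2 * q + 1)) i = i" using \<open>inj w\<close> by (metis injD)
      thus False using no_odd[of "2 * q + 1"] by simp
    qed
    thus "x = 0" by (simp add: vec_eq_iff)
  qed
  hence "invertible (perm_form \<sigma> w)"
    by (simp add: invertible_left_inverse matrix_left_invertible_ker)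
  thus ?thesis by (simp add: invertible_det_nz)
qed

subsection \<open>The centre point and permutations\<close>

lemma exp_vec_pair: "exp_vec (axis i 1 + axis j 1 :: nat ^ 'n) = axis i 1 + axis j (1::real)"
  by (auto simp: exp_vec_def vec_eq_iff axis_def)

text \<open>The exponent is the midpoint of \<open>axis i 2\<close> and
  \<open>axis j 2\<close>.\<close>

lemma pair_in_two_simplex: "exp_vec (axis i 1 + axis j 1 :: nat ^ 'n::finite) \<in> two_simplex"
proof -
  have "(1/2) *\<^sub>R axis i 2 + (1/2) *\<^sub>R axis j (2::real) \<in> (two_simplex :: (real ^ 'n) set)"
    unfolding two_simplex_def
    by (intro convexD[OF convex_convex_hull] hull_inc) auto
  also have "(1/2) *\<^sub>R axis i 2 + (1/2) *\<^sub>R axis j (2::real) = exp_vec (axis i 1 + axis j 1 :: nat ^ 'n)"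
    unfolding exp_vec_pair by (auto simp: vec_eq_iff axis_def)
  finally show ?thesis .
qed

text \<open>All vertices lie on the hyperplane of coordinate sum 2, hence so does their
  hull.\<close>

lemma degree_if_in_two_simplex:
  fixes k :: "nat ^ 'n::finite"
  assumes "exp_vec k \<in> two_simplex"
  shows "(\<Sum>i\<in>UNIV. k $ i) = 2"
proof -
  have "two_simplex \<subseteq> {x :: real ^ 'n. (\<chi> i. 1) \<bullet> x = 2}"
    unfolding two_simplex_def
    by (rule hull_minimal) (auto simp: convex_hyperplane inner_axis)
  hence "(\<chi> i. 1) \<bullet> exp_vec k = 2" using assms by auto
  hence "real (\<Sum>i\<in>UNIV. k $ i) = 2" by (simp add: inner_vec_def exp_vec_def)
  thus ?thesis by linarith
qed

text \<open>In the sum of the \<open>n\<close> exponents each coordinate receives 1 from its own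
  index and 1 from its unique preimage under \<open>\<sigma>\<close>.\<close>

lemma centre_point_in_hull_if_perm:
  fixes \<sigma> :: "'n::finite \<Rightarrow> 'n"
  assumes "bij \<sigma>" and S: "\<And>i. axis i 1 + axis (\<sigma> i) 1 \<in> S"
  shows "centre_point \<in> newton_hull S"
proof -
  let ?e = "\<lambda>i. exp_vec (axis i 1 + axis (\<sigma> i) 1 :: nat ^ 'n)"
  have "(\<Sum>i\<in>UNIV. (1 / real CARD('n)) *\<^sub>R ?e i) \<in> newton_hull S"
    unfolding newton_hull_def
  proof (rule convex_sum)
    fix i show "?e i \<in> convex hull {exp_vec k + l |k l. k \<in> S \<and> (\<forall>i. 0 \<le> l $ i)}"
      by (rule hull_inc) (use S in \<open>force intro: exI[of _ 0]\<close>)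
  qed auto
  also have "(\<Sum>i\<in>UNIV. (1 / real CARD('n)) *\<^sub>R ?e i) = centre_point"
  proof -
    have "l = \<sigma> i \<longleftrightarrow> i = inv \<sigma> l" for i l using \<open>bij \<sigma>\<close> by (metis bij_inv_eq_iff)
    thus ?thesis
      unfolding exp_vec_pair
      by (simp add: vec_eq_iff centre_point_def axis_def sum.distrib
          sum_divide_distrib[symmetric] add_divide_distrib[symmetric])
  qed
  finally show ?thesis .
qed

text \<open>Hall's condition for a set \<open>A\<close> with neighbourhood \<open>N\<close> comes from the functional
  \<open>(\<Sum>i\<in>N. x i) - (\<Sum>i\<in>A. x i) + 3 * ((\<Sum>i. x i) - 2)\<close>: it is nonnegative on the exponents in \<open>S\<close>
  of degree 2 by the choice of \<open>N\<close>, on those of larger degree because of the last summand,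
  and at \<open>centre_point\<close> it equals \<open>2 * (card N - card A) / n\<close>.\<close>

lemma perm_if_centre_point_in_hull:
  fixes S :: "(nat ^ 'n::finite) set"
  assumes centre: "centre_point \<in> newton_hull S"
    and deg: "\<And>k. k \<in> S \<Longrightarrow> 2 \<le> (\<Sum>i\<in>UNIV. k $ i)"
  obtains \<sigma> :: "'n \<Rightarrow> 'n" where "bij \<sigma>" "\<And>i. axis i 1 + axis (\<sigma> i) 1 \<in> S"
proof -
  define E where "E = (\<lambda>i. {j. axis i 1 + axis j 1 \<in> S})"
  have "card A \<le> card (\<Union>(E ` A))" for A
  proof -
    define N where "N = \<Union>(E ` A)"
    \<comment> \<open>The linear part of the functional; its constant -6 moves into the threshold.
      All entries are at least 2, so degree 3 already reaches 6.\<close>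
    define u :: "real ^ 'n" where "u = (\<chi> i. of_bool (i \<in> N) - of_bool (i \<in> A) + 3)"
    have u2: "u $ i \<ge> 2" for i by (simp add: u_def)
    have gen: "u \<bullet> exp_vec k \<ge> 6" if k: "k \<in> S" for k
    proof (cases "(\<Sum>i\<in>UNIV. k $ i) = 2")
      case True
      then obtain i j where ij: "k = axis i 1 + axis j 1" by (rule degree_2_nat_vec)
      \<comment> \<open>Adjacency in \<open>E\<close> is symmetric, so an index in \<open>A\<close>
        is always compensated by its partner in \<open>N\<close>.\<close>
      have "i \<in> A \<Longrightarrow> j \<in> N" "j \<in> A \<Longrightarrow> i \<in> N"
        using k by (auto simp: N_def E_def ij add.commute)
      thus ?thesis
        by (auto simp: ij exp_vec_pair inner_add_right inner_axis u_def)
    next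
      case False
      hence "3 \<le> (\<Sum>i\<in>UNIV. k $ i)" using deg[OF k] by linarith
      hence "6 \<le> 2 * real (\<Sum>i\<in>UNIV. k $ i)" by linarith
      also have "\<dots> = (\<Sum>i\<in>UNIV. 2 * real (k $ i))" by (simp add: sum_distrib_left)
      also have "\<dots> \<le> (\<Sum>i\<in>UNIV. u $ i * real (k $ i))"
        by (intro sum_mono mult_right_mono u2) auto
      finally show ?thesis by (simp add: inner_vec_def exp_vec_def)
    qed
    have "newton_hull S \<subseteq> {x. u \<bullet> x \<ge> 6}"
      unfolding newton_hull_def
    proof (rule hull_minimal)
      show "{exp_vec k + l |k l. k \<in> S \<and> (\<forall>i. 0 \<le> l $ i)} \<subseteq> {x. 6 \<le> u \<bullet> x}"
      proof clarify
        fix k and l :: "real ^ 'n" assume "k \<in> S" "\<forall>i. 0 \<le> l $ i"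
        \<comment> \<open>The entries of \<open>u\<close> are positive, so moving along the orthant
          cannot lower the functional.\<close>
        moreover from this have "0 \<le> u \<bullet> l"
          unfolding inner_vec_def using u2 by (intro sum_nonneg) (auto intro!: mult_nonneg_nonneg order_trans[OF _ u2])
        ultimately show "6 \<le> u \<bullet> (exp_vec k + l)"
          using gen[of k] by (simp add: inner_add_right)
      qed
    qed (rule convex_halfspace_ge)
    hence "6 \<le> u \<bullet> centre_point" using centre by auto
    also have "\<dots> = (2 / real CARD('n)) * (\<Sum>i\<in>UNIV. u $ i)"
      by (simp add: inner_vec_def centre_point_def sum_divide_distrib sum_distrib_left mult.commute)
    also have "(\<Sum>i\<in>UNIV. u $ i) = real (card N) - real (card A) + 3 * real CARD('n)"
      by (simp add: u_def sum.distrib sum_subtractf of_bool_def sum.If_cases Collect_mem_eq)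
    finally have "real (card A) \<le> real (card N)"
      by (simp add: field_simps)
    thus ?thesis by (simp add: N_def)
  qed
  then obtain \<sigma> where "inj \<sigma>" "\<And>i. \<sigma> i \<in> E i"
    using hall_marriage[of UNIV E] by auto
  thus ?thesis using that[of \<sigma>] by (auto simp: E_def bij_def finite_UNIV_inj_surj)
qed

subsection \<open>Generic quadratic forms\<close>

lemma polynomial_fun_sum:
  assumes "\<And>x. x \<in> A \<Longrightarrow> polynomial_fun (p x)"
  shows "polynomial_fun (\<lambda>b. \<Sum>x\<in>A. p x b)"
  using assms
  by (induction A rule: infinite_finite_induct)
     (simp_all add: polynomial_fun.const polynomial_fun.add)

lemma polynomial_fun_prod:
  assumes "\<And>x. x \<in> A \<Longrightarrow> polynomial_fun (p x)"
  shows "polynomial_fun (\<lambda>b. \<Prod>x\<in>A. p x b)"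
  using assms
  by (induction A rule: infinite_finite_induct)
     (simp_all add: polynomial_fun.const polynomial_fun.mult)

lemma polynomial_fun_det:
  fixes m :: "('v \<Rightarrow> complex) \<Rightarrow> complex ^ 'n ^ 'n::finite"
  assumes "\<And>i j. polynomial_fun (\<lambda>b. m b $ i $ j)"
  shows "polynomial_fun (\<lambda>b. det (m b))"
  unfolding det_def
  by (intro polynomial_fun_sum polynomial_fun.mult polynomial_fun.const polynomial_fun_prod assms)

lemma polynomial_fun_det_form_hessian: "polynomial_fun (\<lambda>b. det (form_hessian b))"
  by (rule polynomial_fun_det)
     (simp only: form_hessian_def vec_lambda_beta,
      intro polynomial_fun.mult polynomial_fun.const polynomial_fun.coord)

lemma pair_eq_iff:
  "axis i 1 + axis j 1 = (axis k 1 + axis l 1 :: nat ^ 'n) \<longleftrightarrow> i = k \<and> j = l \<or> i = l \<and> j = k"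
proof
  assume eq: "axis i 1 + axis j 1 = (axis k 1 + axis l 1 :: nat ^ 'n)"
  have "(axis i 1 + axis j 1) $ m = (axis k 1 + axis l 1 :: nat ^ 'n) $ m" for m by (simp add: eq)
  from this[of i] this[of j] this[of k] this[of l]
  show "i = k \<and> j = l \<or> i = l \<and> j = k" by (auto simp: axis_def split: if_splits)
qed (auto simp: add.commute)

lemma poly_space_nonsingular_form:
  fixes A :: "(real ^ 'n::finite) set"
  assumes "bij \<sigma>" and A: "\<And>i. exp_vec (axis i 1 + axis (\<sigma> i) 1) \<in> A"
  obtains b where "b \<in> poly_space A" "det (form_hessian b) \<noteq> 0"
proof -
  obtain w :: "'n \<Rightarrow> nat" where w: "inj w" "\<And>i. prime (w i)"
    using inj_primes by blast
  let ?e = "\<lambda>i. axis i 1 + axis (\<sigma> i) 1 :: nat ^ 'n"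
  \<comment> \<open>A sum over \<open>i\<close>, because the two indices of a 2-cycle of
    \<open>\<sigma>\<close> give the same exponent and their weights must add.\<close>
  define b where "b = (\<lambda>k. \<Sum>i\<in>UNIV. if k = ?e i then complex_of_nat (w i) else 0)"
  have supp: "k \<in> range ?e" if "b k \<noteq> 0" for k
  proof -
    from that obtain i where "(if k = ?e i then complex_of_nat (w i) else 0) \<noteq> 0"
      unfolding b_def by (rule sum.not_neutral_contains_not_neutral)
    thus ?thesis by (cases "k = ?e i") auto
  qed
  have "finite {k. b k \<noteq> 0}" by (rule finite_subset[of _ "range ?e"]) (use supp in auto)
  hence "b \<in> poly_space A" using supp A by (auto simp: poly_space_def)
  moreover have "form_hessian b = perm_form \<sigma> w"
  proof -
    have "form_hessian b $ i $ j = perm_form \<sigma> w $ i $ j" for i j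
    proof -
      \<comment> \<open>The condition \<open>i \<noteq> j\<close> counts the weight of a fixed point
        once; the diagonal factor in \<open>form_hessian\<close> then doubles it.\<close>
      have "b (axis i 1 + axis j 1) = (\<Sum>l\<in>UNIV. (if l = i then if \<sigma> i = j then of_nat (w i) else 0 else 0)
          + (if l = j then if \<sigma> j = i \<and> i \<noteq> j then of_nat (w j) else 0 else 0))"
        unfolding b_def pair_eq_iff by (intro sum.cong) auto
      also have "\<dots> = (if \<sigma> i = j then of_nat (w i) else 0)
          + (if \<sigma> j = i \<and> i \<noteq> j then of_nat (w j) else 0)"
        by (simp add: sum.distrib)
      finally show ?thesis by (auto simp: form_hessian_def perm_form_def)
    qed
    thus ?thesis by (simp add: vec_eq_iff)
  qed
  ultimately show ?thesis using that det_perm_form_nonzero[OF \<open>bij \<sigma>\<close> w] by metis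
qed

lemma perm_if_det_nonzero:
  fixes H :: "complex ^ 'n ^ 'n::finite"
  assumes "det H \<noteq> 0"
  obtains \<sigma> where "bij \<sigma>" "\<And>i. H $ i $ \<sigma> i \<noteq> 0"
proof -
  obtain \<sigma> where "\<sigma> \<in> {\<sigma>. \<sigma> permutes UNIV}" "of_int (sign \<sigma>) * (\<Prod>i\<in>UNIV. H $ i $ \<sigma> i) \<noteq> 0"
    using assms unfolding det_def by (rule sum.not_neutral_contains_not_neutral)
  thus ?thesis using that[of \<sigma>] by (simp add: permutes_bij)
qed

section \<open>The necessary and the sufficient condition\<close>

theorem theorem4:
  shows "(\<forall>f :: complex ^ 'n::finite \<Rightarrow> complex.
            analytic_0 f \<longrightarrow> singular_0 f \<longrightarrow> centre_point \<notin> newton_polytope f \<longrightarrow> \<not> morse_0 f)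
       \<and> (\<forall>M :: (real ^ 'n) set.
            lattice_polytope M \<longrightarrow> centre_point \<in> M \<longrightarrow> centre_point \<in> singular_part M \<longrightarrow>
            generically (poly_space (M \<inter> two_simplex))
              (\<lambda>b. \<forall>f :: complex ^ 'n \<Rightarrow> complex.
                     analytic_0 f \<longrightarrow> singular_0 f \<longrightarrow> newton_polytope f \<subseteq> M \<longrightarrow>
                     (\<lambda>z. f z - poly_eval b z) \<in> o[at 0](\<lambda>z. of_real (norm z ^ 2)) \<longrightarrow>
                     morse_0 f))"
  (is "?necessary \<and> ?sufficient")
proof
  show ?necessary
  proof (intro allI impI notI)
    fix f :: "complex ^ 'n \<Rightarrow> complex"
    assume f: "analytic_0 f" "centre_point \<notin> newton_polytope f" "morse_0 f"
    have ps: "has_power_series_0 f (series_coeff f)"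
      using f(1) unfolding analytic_0_def series_coeff_def by (rule someI_ex)
    have "det (form_hessian (series_coeff f)) \<noteq> 0"
      using f(3) by (simp add: morse_0_def hessian_matrix_0_eq_form_hessian[OF ps])
    then obtain \<sigma> where "bij \<sigma>" "\<And>i. form_hessian (series_coeff f) $ i $ \<sigma> i \<noteq> 0"
      using perm_if_det_nonzero by blast
    \<comment> \<open>A nonzero Hessian entry means a nonzero series coefficient, so the exponents
      belonging to \<open>\<sigma>\<close> lie in the support of \<open>f\<close>.\<close>
    hence "centre_point \<in> newton_polytope f"
      unfolding newton_polytope_def
      by (intro centre_point_in_hull_if_perm) (auto simp: form_hessian_def)
    with f(2) show False by blast
  qed
  show ?sufficient
  proof (intro allI impI)
    fix M :: "(real ^ 'n) set"
    assume "centre_point \<in> singular_part M"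
    \<comment> \<open>The generators of \<open>singular_part M\<close> have degree at least 2 by
      construction, as the Hall argument demands.\<close>
    then obtain \<sigma> :: "'n \<Rightarrow> 'n" where \<sigma>: "bij \<sigma>"
        "\<And>i. axis i 1 + axis (\<sigma> i) 1 \<in> {k. exp_vec k \<in> M \<and> 2 \<le> (\<Sum>i\<in>UNIV. k $ i)}"
      unfolding singular_part_def using perm_if_centre_point_in_hull by blast
    let ?W = "poly_space (M \<inter> two_simplex)"
    define V where "V = {b \<in> ?W. det (form_hessian b) = 0}"
    have "algebraic_subvariety ?W V"
      unfolding algebraic_subvariety_def V_def
      by (rule exI[of _ "{\<lambda>b. det (form_hessian b)}"]) (simp add: polynomial_fun_det_form_hessian)
    \<comment> \<open>The prime-weighted form lies outside \<open>V\<close>, so \<open>V\<close> is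
      a proper subvariety.\<close>
    moreover obtain b where "b \<in> ?W" "det (form_hessian b) \<noteq> 0"
      using \<sigma>(1) by (rule poly_space_nonsingular_form[of \<sigma> "M \<inter> two_simplex"])
        (use \<sigma>(2) pair_in_two_simplex in auto)
    hence "V \<noteq> ?W" by (auto simp: V_def)
    moreover have "morse_0 f"
      if b: "b \<in> ?W - V" and f: "analytic_0 f" "singular_0 f"
        and small: "(\<lambda>z. f z - poly_eval b z) \<in> o[at 0](\<lambda>z. of_real (norm z ^ 2))"
      for b and f :: "complex ^ 'n \<Rightarrow> complex"
    proof -
      obtain a where a: "has_power_series_0 f a"
        using f(1) unfolding analytic_0_def by blast
      have "(\<Sum>i\<in>UNIV. k $ i) = 2" if "b k \<noteq> 0" for k
        using b that by (intro degree_if_in_two_simplex) (auto simp: poly_space_def)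
      \<comment> \<open>The Hessian sees only the quadratic coefficients, and on these the
        asymptotic condition makes \<open>a\<close> and \<open>b\<close> agree.\<close>
      hence "form_hessian a = form_hessian b"
        using quadratic_coeff_eq_if_smallo[OF a f(2) _ small]
        by (auto simp: form_hessian_def vec_eq_iff)
      thus ?thesis
        using b f(2) by (simp add: V_def morse_0_def hessian_matrix_0_eq_form_hessian[OF a])
    qed
    ultimately show "generically ?W (\<lambda>b. \<forall>f :: complex ^ 'n \<Rightarrow> complex.
        analytic_0 f \<longrightarrow> singular_0 f \<longrightarrow> newton_polytope f \<subseteq> M \<longrightarrow>
        (\<lambda>z. f z - poly_eval b z) \<in> o[at 0](\<lambda>z. of_real (norm z ^ 2)) \<longrightarrow> morse_0 f)"
      unfolding generically_def by blast
  qed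
qed

end
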